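(* For each integer $N\ge 1$ let $\omega_{2N+1}\subset\mathbb{S}^2$ be the Fibonacci configuration, consisting of the $2N+1$ points with longitude $\theta_i$ and latitude $\phi_i\in[-\pi/2,\pi/2]$ given by $$\theta_i=2\pi i\varphi^{-1},\qquad \sin\phi_i=\frac{2i}{2N+1},\qquad -N\le i\le N,$$ where $\varphi=(1+\sqrt5)/2$. Then the sequence of Fibonacci configurations $\{\omega_{2N+1}\}_{N\ge1}$ is quasi-uniform.
   Context: $\mathbb{S}^2=\{x\in\mathbb{R}^3:|x|=1\}$ with $|\cdot|$ the Euclidean norm. The point with latitude $\phi$ and longitude $\theta$ is $(\cos\phi\cos\theta,\cos\phi\sin\theta,\sin\phi)$. For a finite configuration $\omega\subset\mathbb{S}^2$ with at least two points, the separation is $\delta(\omega)=\min_{x\ne y\in\omega}|x-y|$, the covering radius is $\eta(\omega)=\max_{y\in\mathbb{S}^2}\min_{x\in\omega}|x-y|$, and the mesh ratio is $\gamma(\omega)=\eta(\omega)/\delta(\omega)$. A sequence of configurations is quasi-uniform if its sequence of mesh ratios is bounded. *)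

theory Defs
  imports "HOL-Analysis.Analysis"
begin

definition geo_point :: "real \<Rightarrow> real \<Rightarrow> real ^ 3" where
  "geo_point lat lon = vector [cos lat * cos lon, cos lat * sin lon, sin lat]"

definition spherical_config :: "(real ^ 3) set \<Rightarrow> bool" where
  "spherical_config \<omega> \<longleftrightarrow> finite \<omega> \<and> card \<omega> \<ge> 2 \<and> \<omega> \<subseteq> sphere 0 1"

definition separation :: "(real ^ 3) set \<Rightarrow> real" where
  "separation \<omega> = Min {dist x y | x y. x \<in> \<omega> \<and> y \<in> \<omega> \<and> x \<noteq> y}"

text \<open>For a nonempty finite set the supremum is a maximum, see \<open>covering_radius_attained\<close> below.\<close>

definition covering_radius :: "(real ^ 3) set \<Rightarrow> real" where
  "covering_radius \<omega> = (SUP y\<in>sphere 0 1. Min ((\<lambda>x. dist x y) ` \<omega>))"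

definition mesh_ratio :: "(real ^ 3) set \<Rightarrow> real" where
  "mesh_ratio \<omega> = covering_radius \<omega> / separation \<omega>"

text \<open>The sequence is indexed by the natural numbers in \<open>I\<close>.\<close>

definition quasi_uniform_on :: "nat set \<Rightarrow> (nat \<Rightarrow> (real ^ 3) set) \<Rightarrow> bool" where
  "quasi_uniform_on I \<omega> \<longleftrightarrow>
     (\<forall>n\<in>I. spherical_config (\<omega> n)) \<and> bounded ((\<lambda>n. mesh_ratio (\<omega> n)) ` I)"

definition golden_ratio :: real where
  "golden_ratio = (1 + sqrt 5) / 2"

definition fib_longitude :: "int \<Rightarrow> real" where
  "fib_longitude i = 2 * pi * of_int i * inverse golden_ratio"

definition fib_latitude :: "nat \<Rightarrow> int \<Rightarrow> real" where
  "fib_latitude N i = arcsin (2 * of_int i / (2 * real N + 1))"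

text \<open>The index \<open>N\<close> stands for the configuration of \<open>2 * N + 1\<close> points.\<close>

definition fibonacci_config :: "nat \<Rightarrow> (real ^ 3) set" where
  "fibonacci_config N =
     (\<lambda>i. geo_point (fib_latitude N i) (fib_longitude i)) ` {- int N..int N}"

lemma fib_latitude_unique:
  assumes "- int N \<le> i" "i \<le> int N"
  shows "lat = fib_latitude N i \<longleftrightarrow>
    lat \<in> {- (pi / 2)..pi / 2} \<and> sin lat = 2 * of_int i / (2 * real N + 1)"
proof -
  have "- real N \<le> of_int i" "of_int i \<le> real N"
    using assms by linarith+
  then have "- 1 \<le> 2 * of_int i / (2 * real N + 1)" "2 * of_int i / (2 * real N + 1) \<le> 1"
    by (simp_all add: field_simps)
  then show ?thesis
    unfolding fib_latitude_def using arcsin_sin arcsin by fastforce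
qed

lemma card_fibonacci_config: "card (fibonacci_config N) = 2 * N + 1"
proof -
  have "inj_on (\<lambda>i. geo_point (fib_latitude N i) (fib_longitude i)) {- int N..int N}"
  proof (rule inj_onI)
    fix i j
    assume i: "i \<in> {- int N..int N}" and j: "j \<in> {- int N..int N}"
      and eq: "geo_point (fib_latitude N i) (fib_longitude i) =
               geo_point (fib_latitude N j) (fib_longitude j)"
    have "sin (fib_latitude N i) = sin (fib_latitude N j)"
      using arg_cong[OF eq, of "\<lambda>v. v $ 3"] by (simp add: geo_point_def)
    then have "2 * of_int i / (2 * real N + 1) = 2 * of_int j / (2 * real N + 1)"
      using i j fib_latitude_unique by (metis atLeastAtMost_iff)
    then show "i = j"
      by (simp add: divide_simps split: if_splits)
  qed
  then show ?thesis
    unfolding fibonacci_config_def by (simp add: card_image)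
qed

lemma covering_radius_attained:
  assumes "finite \<omega>" "\<omega> \<noteq> {}"
  shows "\<exists>y\<in>sphere 0 1. covering_radius \<omega> = Min ((\<lambda>x. dist x y) ` \<omega>) \<and>
    (\<forall>z\<in>sphere 0 1. Min ((\<lambda>x. dist x z) ` \<omega>) \<le> covering_radius \<omega>)"
proof -
  let ?f = "\<lambda>y. Min ((\<lambda>x. dist x y) ` \<omega>)"
  have "?f y = infdist y \<omega>" for y
    using assms by (simp add: infdist_def cInf_eq_Min dist_commute)
  then have "continuous_on (sphere 0 1) ?f"
    by (simp add: continuous_on_infdist)
  moreover have "sphere (0 :: real ^ 3) 1 \<noteq> {}"
    by simp
  ultimately obtain y where y: "y \<in> sphere 0 1" "\<forall>z\<in>sphere 0 1. ?f z \<le> ?f y"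
    using continuous_attains_sup[OF compact_sphere] by blast
  then have "covering_radius \<omega> = ?f y"
    unfolding covering_radius_def by (intro cSup_eq_maximum) auto
  with y show ?thesis
    by auto
qed

end

theory Submission
  imports Defs
begin

text \<open>
  Let \<open>M = 2 * N + 1\<close> and let \<open>\<alpha>\<close> be the inverse of the golden ratio. The integral form
  \<open>p\<^sup>2 + p k - k\<^sup>2 = (p - k \<alpha>) (p + k (1 + \<alpha>))\<close> has no nontrivial zeros, so \<open>k \<alpha>\<close> stays at distance
  at least \<open>1 / (3 k)\<close> from the integers; and it takes the values \<open>\<plusminus>1\<close> at Fibonacci pairs, so any \<open>K\<close>
  consecutive multiples of \<open>\<alpha>\<close> come within \<open>3 / K\<close> of every point modulo 1.

  Two points whose indices differ by \<open>k\<close> and that lie at distance about \<open>r\<close> from the axis are at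
  latitudinal distance of order at least \<open>k / (M r)\<close> and at longitudinal distance of order at least
  \<open>r / k\<close>. The product of these is of order \<open>1 / M\<close>, so the separation is at least of order
  \<open>1 / sqrt M\<close>. Conversely, given a point of the sphere at distance \<open>R\<close> from the axis, the roughly
  \<open>R sqrt M\<close> configuration points nearest in height have latitudinal distance of order
  \<open>1 / sqrt M\<close> from it, and one of them also has longitudinal distance of that order.
\<close>

section \<open>Diophantine properties of the golden ratio\<close>

lemma inverse_golden_ratio:
  "inverse golden_ratio * inverse golden_ratio = 1 - inverse golden_ratio"
  "1 / 2 < inverse golden_ratio" "inverse golden_ratio < 5 / 8"
proof -
  have s: "sqrt 5 * sqrt 5 = 5" by simp
  have b: "2 < sqrt 5" "sqrt 5 < 9 / 4"
    using real_less_rsqrt[of 2 5] real_less_lsqrt[of "9 / 4" 5] by (simp_all add: power2_eq_square)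
  have inv: "inverse golden_ratio = (sqrt 5 - 1) / 2"
    unfolding golden_ratio_def by (rule inverse_unique) (simp add: field_simps s)
  show "inverse golden_ratio * inverse golden_ratio = 1 - inverse golden_ratio"
    unfolding inv using s by (simp add: field_simps)
  show "1 / 2 < inverse golden_ratio" "inverse golden_ratio < 5 / 8"
    unfolding inv using b by simp_all
qed

text \<open>The norm form of the ring of integers of the field generated by \<open>sqrt 5\<close>.\<close>

definition golden_norm :: "int \<Rightarrow> int \<Rightarrow> int" where
  "golden_norm p k = p * p + p * k - k * k"

lemma golden_norm_factor:
  "of_int (golden_norm p k) =
    (of_int p - of_int k * inverse golden_ratio) * (of_int p + of_int k * (1 + inverse golden_ratio))"
proof -
  define a where "a = inverse golden_ratio"
  have "(of_int p - of_int k * a) * (of_int p + of_int k * (1 + a))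
      = of_int p * of_int p + of_int p * of_int k - of_int k * of_int k * (a + a * a)"
    by (simp add: algebra_simps)
  then show ?thesis
    using inverse_golden_ratio(1) by (simp add: golden_norm_def flip: a_def)
qed

text \<open>Infinite descent: modulo 2 the form vanishes only when both arguments are even, and
  halving both gives a smaller zero.\<close>

lemma golden_norm_eq_0: "golden_norm p k = 0 \<Longrightarrow> k = 0"
proof (induction "nat \<bar>k\<bar>" arbitrary: p k rule: less_induct)
  case less
  have "even (golden_norm p k)" using less.prems by simp
  then have "even p \<and> even k"
    unfolding golden_norm_def by (auto simp: even_add even_mult_iff)
  then obtain p' k' where pk: "p = 2 * p'" "k = 2 * k'" by (auto elim!: evenE)
  have "golden_norm p' k' = 0"
    using less.prems unfolding pk golden_norm_def by (simp add: algebra_simps)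
  then show ?case
    using less.hyps[of k' p'] unfolding pk by (cases "k' = 0") (auto simp: abs_mult)
qed

text \<open>A nonzero integer norm is at least 1 in absolute value. It factors into the
  approximation error and a second factor of size about \<open>(1 + 2 * a) * l\<close>, so the error
  cannot be much smaller than \<open>1 / l\<close>.\<close>

lemma golden_ratio_badly_approximable:
  assumes "k \<noteq> 0"
  shows "1 / (3 * \<bar>of_int k\<bar>) \<le> \<bar>of_int k * inverse golden_ratio - of_int p\<bar>"
proof (rule ccontr)
  define a where "a = inverse golden_ratio"
  define e where "e = \<bar>of_int k * a - of_int p\<bar>"
  define l where "l = \<bar>real_of_int k\<bar>"
  assume "\<not> ?thesis"
  then have e: "e < 1 / (3 * l)" by (simp add: e_def l_def a_def)
  have a: "1 / 2 < a" "a < 5 / 8" using inverse_golden_ratio by (auto simp: a_def)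
  have l: "l \<ge> 1" using assms unfolding l_def by linarith
  have el: "e * l < 1 / 3" using e l by (simp add: field_simps)
  have e0: "0 \<le> e" by (simp add: e_def)
  have e1: "e < 1 / 3" using el mult_left_mono[OF l e0] by simp
  have "golden_norm p k \<noteq> 0" using golden_norm_eq_0 assms by blast
  then have "1 \<le> \<bar>golden_norm p k\<bar>" by linarith
  then have "1 \<le> \<bar>real_of_int (golden_norm p k)\<bar>" by linarith
  also have "\<dots> = e * \<bar>of_int p + of_int k * (1 + a)\<bar>"
    by (simp add: golden_norm_factor abs_mult e_def abs_minus_commute flip: a_def)
  also have "of_int p + of_int k * (1 + a) = (of_int p - of_int k * a) + of_int k * (1 + 2 * a)"
    by (simp add: algebra_simps)
  also have "e * \<bar>\<dots>\<bar> \<le> e * (e + l * (1 + 2 * a))"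
  proof (rule mult_left_mono[OF _ e0])
    have "\<bar>of_int k * (1 + 2 * a)\<bar> = l * (1 + 2 * a)" using a by (simp add: abs_mult l_def)
    then show "\<bar>(of_int p - of_int k * a) + of_int k * (1 + 2 * a)\<bar> \<le> e + l * (1 + 2 * a)"
      unfolding e_def by linarith
  qed
  also have "\<dots> = e * e + e * l * (1 + 2 * a)" by (simp add: algebra_simps)
  \<comment> \<open>The bound is 1/9 + 3/4 = 31/36, which is below 1; the factor 9/4 comes from
    \<open>a < 5 / 8\<close>.\<close>
  also have "\<dots> \<le> 1 / 3 * (1 / 3) + 1 / 3 * (9 / 4)"
    using e0 e1 el l a by (intro add_mono mult_mono) auto
  finally show False by simp
qed

text \<open>The pairs found here are consecutive Fibonacci numbers.\<close>

lemma golden_norm_unit_pair: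
  assumes "K \<ge> (1 :: int)"
  shows "\<exists>p q. \<bar>golden_norm p q\<bar> = 1 \<and> 1 \<le> p \<and> p \<le> q \<and> q \<le> K \<and> K < 2 * q"
  using assms
proof (induction K rule: int_ge_induct)
  case base
  have "\<bar>golden_norm 1 1\<bar> = 1" by (simp add: golden_norm_def)
  then show ?case by (intro exI[of _ 1]) simp
next
  case (step K)
  then obtain p q where pq: "\<bar>golden_norm p q\<bar> = 1" "1 \<le> p" "p \<le> q" "q \<le> K" "K < 2 * q"
    by blast
  show ?case
  proof (cases "K + 1 < 2 * q")
    case True
    then show ?thesis using pq by (intro exI[of _ p] exI[of _ q]) auto
  next
    case False
    \<comment> \<open>In this case \<open>K + 1 = 2 * q\<close>, so \<open>p \<le> q\<close> makes
      the next pair fit below \<open>K + 1\<close>, and \<open>1 \<le> p\<close> gives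
      \<open>K + 1 < 2 * (p + q)\<close>.\<close>
    have "golden_norm q (p + q) = - golden_norm p q"
      by (simp add: golden_norm_def algebra_simps)
    then show ?thesis using pq False by (intro exI[of _ q] exI[of _ "p + q"]) auto
  qed
qed

text \<open>Replace \<alpha> by the fraction \<open>p / q\<close> of a unit pair. The multiples
  \<open>j * p\<close> with \<open>0 \<le> j < q\<close> meet every residue modulo \<open>q\<close>,
  so one of them hits the multiple of \<open>1 / q\<close> nearest to the target. Rounding costs
  \<open>1 / (2 * q)\<close>, replacing \<alpha> costs at most \<open>1 / q\<close>, and
  \<open>K < 2 * q\<close> turns the sum into \<open>3 / K\<close>.\<close>

lemma golden_ratio_multiples_dense:
  assumes "K \<ge> (1 :: int)"
  shows "\<exists>i p. n \<le> i \<and> i < n + K \<and>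
    \<bar>of_int i * inverse golden_ratio - x - of_int p\<bar> \<le> 3 / of_int K"
proof -
  define a where "a = inverse golden_ratio"
  obtain p q where pq: "\<bar>golden_norm p q\<bar> = 1" "1 \<le> p" "p \<le> q" "q \<le> K" "K < 2 * q"
    using golden_norm_unit_pair[OF assms] by blast
  define s where "s = golden_norm p q"
  have ss: "s * s = 1" using pq(1) unfolding s_def by (metis abs_mult_self_eq mult_1)
  have a: "1 / 2 < a" "a < 5 / 8" using inverse_golden_ratio by (auto simp: a_def)
  define Q where "Q = real_of_int q"
  have Q: "Q \<ge> 1" using pq unfolding Q_def by linarith
  have eps: "\<bar>Q * a - of_int p\<bar> \<le> 1 / Q"
  proof -
    have "1 = \<bar>real_of_int (golden_norm p q)\<bar>" using pq(1) by linarith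
    also have "\<dots> = \<bar>Q * a - of_int p\<bar> * \<bar>of_int p + Q * (1 + a)\<bar>"
      by (simp add: golden_norm_factor abs_mult abs_minus_commute Q_def flip: a_def)
    also have "\<dots> \<ge> \<bar>Q * a - of_int p\<bar> * Q"
    proof (rule mult_left_mono)
      have "Q * a \<ge> 0" "real_of_int p \<ge> 0" using Q a pq by auto
      then show "Q \<le> \<bar>of_int p + Q * (1 + a)\<bar>" by (simp add: algebra_simps)
    qed simp
    finally show ?thesis using Q by (simp add: field_simps)
  qed
  define u where "u = x - of_int n * a"
  define r where "r = round (u * Q)"
  define j where "j = (s * p * r) mod q"
  \<comment> \<open>Substituting \<open>p * p = s + q * q - p * q\<close> and
    \<open>s * s = 1\<close> in \<open>j * p\<close> leaves \<open>r\<close> plus this multiple of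
    \<open>q\<close>.\<close>
  define b where "b = s * r * (q - p) - ((s * p * r) div q) * p"
  have j: "0 \<le> j" "j < q" using pq by (auto simp: j_def)
  text \<open>Because \<open>p * p\<close> is congruent to \<open>s\<close> modulo \<open>q\<close>, multiplication by \<open>s * p\<close> inverts
    multiplication by \<open>p\<close>.\<close>
  have jp: "j * p = r + b * q"
  proof -
    have "j = s * p * r - q * ((s * p * r) div q)"
      unfolding j_def by (simp add: minus_mult_div_eq_mod)
    then have "j * p = (s * p * r - q * ((s * p * r) div q)) * p"
      by (rule arg_cong)
    also have "\<dots> = s * r * (p * p) - q * ((s * p * r) div q) * p"
      by (simp add: algebra_simps)
    also have "p * p = s + q * q - p * q" by (simp add: s_def golden_norm_def)
    also have "s * r * (s + q * q - p * q) = (s * s) * r + s * r * (q - p) * q"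
      by (simp add: algebra_simps)
    finally show ?thesis by (simp add: ss b_def algebra_simps)
  qed
  have jp': "of_int j * of_int p = of_int r + of_int b * Q"
    using arg_cong[OF jp, of real_of_int] by (simp add: Q_def)
  have "of_int (n + j) * a - x - of_int b
      = (of_int r - u * Q) / Q + of_int j * (Q * a - of_int p) / Q"
    using Q jp' by (simp add: u_def field_simps)
  also have "\<bar>\<dots>\<bar> \<le> (1 / 2) / Q + 1 / Q"
  proof (rule order.trans[OF abs_triangle_ineq add_mono])
    show "\<bar>(of_int r - u * Q) / Q\<bar> \<le> (1 / 2) / Q"
      using divide_right_mono[OF of_int_round_abs_le[of "u * Q"], of Q] Q
      by (simp add: r_def abs_divide)
    have "\<bar>of_int j * (Q * a - of_int p)\<bar> \<le> Q * (1 / Q)"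
      unfolding abs_mult using eps j Q by (intro mult_mono) (auto simp: Q_def)
    then show "\<bar>of_int j * (Q * a - of_int p) / Q\<bar> \<le> 1 / Q"
      using Q by (simp add: abs_divide divide_right_mono)
  qed
  also have "\<dots> = 3 / (2 * Q)" by (simp add: field_simps)
  also have "\<dots> \<le> 3 / of_int K"
    using pq assms by (intro divide_left_mono) (auto simp: Q_def)
  finally show ?thesis
    using j pq by (intro exI[of _ "n + j"] exI[of _ b]) (auto simp: a_def)
qed

section \<open>Distances on the sphere\<close>

text \<open>The first two summands are the squared chord between points of equal longitude; the last
  one is the contribution of the longitudes. The two parts are estimated separately below.\<close>

lemma dist_geo_point:
  "(dist (geo_point a s) (geo_point b t))\<^sup>2 =
    (sin a - sin b)\<^sup>2 + (cos a - cos b)\<^sup>2 + 4 * cos a * cos b * (sin ((s - t) / 2))\<^sup>2"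
proof -
  have "(dist (geo_point a s) (geo_point b t))\<^sup>2
      = (cos a * cos s - cos b * cos t)\<^sup>2 + (cos a * sin s - cos b * sin t)\<^sup>2 + (sin a - sin b)\<^sup>2"
    by (simp add: geo_point_def dist_vec_def L2_set_def sum_3 dist_real_def)
  also have "\<dots> = (sin a - sin b)\<^sup>2 + (cos a)\<^sup>2 * ((sin s)\<^sup>2 + (cos s)\<^sup>2)
      + (cos b)\<^sup>2 * ((sin t)\<^sup>2 + (cos t)\<^sup>2) - 2 * cos a * cos b * (cos s * cos t + sin s * sin t)"
    by algebra
  also have "cos s * cos t + sin s * sin t = cos (2 * ((s - t) / 2))"
    using cos_diff[of s t] by (simp only: field_sum_of_halves mult_2 add_divide_distrib)
  also have "\<dots> = 1 - 2 * (sin ((s - t) / 2))\<^sup>2"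
    by (rule cos_double_sin)
  finally show ?thesis
    using sin_cos_squared_add[of a] sin_cos_squared_add[of b]
      sin_cos_squared_add[of s] sin_cos_squared_add[of t] by algebra
qed

lemma geo_point_in_sphere: "geo_point a s \<in> sphere 0 1"
proof -
  have "(norm (geo_point a s))\<^sup>2 = (cos a)\<^sup>2 * ((cos s)\<^sup>2 + (sin s)\<^sup>2) + (sin a)\<^sup>2"
    by (simp add: geo_point_def norm_vec_def L2_set_def sum_3 power_mult_distrib
        distrib_left del: sin_cos_squared_add sin_cos_squared_add2)
  also have "\<dots> = 1" by simp
  finally have "norm (geo_point a s) = 1" by (rule power2_eq_imp_eq[where y = 1, simplified]) auto
  then show ?thesis by simp
qed

lemma sphere_eq_geo_point:
  assumes "y \<in> sphere 0 1"
  obtains a t where "y = geo_point a t" "- (pi / 2) \<le> a" "a \<le> pi / 2"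
proof -
  have n: "(y $ 1)\<^sup>2 + (y $ 2)\<^sup>2 + (y $ 3)\<^sup>2 = 1"
    using assms by (simp add: norm_vec_def L2_set_def sum_3)
  then have "(y $ 3)\<^sup>2 \<le> 1" by (smt (verit) zero_le_power2)
  then have y3: "- 1 \<le> y $ 3" "y $ 3 \<le> 1" by (auto simp: abs_square_le_1 abs_le_iff)
  define c where "c = cos (arcsin (y $ 3))"
  have c2: "c\<^sup>2 = (y $ 1)\<^sup>2 + (y $ 2)\<^sup>2"
    using y3 n by (simp add: c_def cos_squared_eq)
  have c0: "c \<ge> 0" unfolding c_def using arcsin_bounded[OF y3] by (simp add: cos_ge_zero)
  have "cmod (Complex (y $ 1) (y $ 2)) = c"
    using c0 c2 by (simp add: cmod_def real_sqrt_unique)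
  then obtain t where "Complex (y $ 1) (y $ 2) = rcis c t"
    by (metis rcis_cmod_Arg)
  then have "y $ 1 = c * cos t" "y $ 2 = c * sin t"
    by (auto simp: complex_eq_iff)
  then have "y = geo_point (arcsin (y $ 3)) t"
    using y3 by (simp add: geo_point_def vec_eq_iff forall_3 c_def)
  with that arcsin_bounded[OF y3] show thesis by blast
qed

text \<open>The sine is concave on \<open>{0..pi / 2}\<close>, so its graph lies above the chord
  joining the end points.\<close>

lemma Jordan_sin_ge:
  assumes "0 \<le> x" "x \<le> 1 / 2"
  shows "2 * x \<le> sin (pi * x)"
proof -
  have "concave_on {0..pi / 2} sin"
    by (rule f''_le0_imp_concave[where f' = cos and f'' = "\<lambda>x. - sin x"])
      (auto intro!: derivative_eq_intros sin_ge_zero)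
  then have "(1 - 2 * x) * sin 0 + (2 * x) * sin (pi / 2) \<le> sin ((1 - 2 * x) *\<^sub>R 0 + (2 * x) *\<^sub>R (pi / 2))"
    using assms by (intro concave_onD) auto
  then show ?thesis by (simp add: mult.commute)
qed

lemma abs_sin_pi_diff_int: "\<bar>sin (pi * (x - of_int p))\<bar> = \<bar>sin (pi * x)\<bar>"
proof -
  have "\<bar>cos (pi * of_int p)\<bar> = 1" by (simp add: cos_npi_int)
  then show ?thesis by (simp add: right_diff_distrib sin_diff abs_mult)
qed

lemma abs_sin_pi_ge: "2 * \<bar>x - of_int (round x)\<bar> \<le> \<bar>sin (pi * x)\<bar>"
proof -
  define v where "v = x - of_int (round x)"
  have "\<bar>v\<bar> \<le> 1 / 2" using of_int_round_abs_le[of x] by (simp add: v_def abs_minus_commute)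
  then have "2 * \<bar>v\<bar> \<le> sin (pi * \<bar>v\<bar>)" by (intro Jordan_sin_ge) auto
  also have "\<dots> \<le> \<bar>sin (pi * v)\<bar>" by (cases "v \<ge> 0") auto
  finally show ?thesis by (simp add: v_def abs_sin_pi_diff_int)
qed

text \<open>Near a pole a difference in height forces a much larger distance. If \<open>D\<close> is
  the squared chord in a meridian half-plane, then
  \<open>(z - w)\<^sup>2 = D / 2 * (1 + r * s - z * w)\<close>, and the last factor is at most
  \<open>4 * r\<^sup>2\<close> unless the points lie near opposite poles. In that case their heights
  alone differ by at least 1.\<close>

lemma chord_ge:
  fixes r s z w :: real
  assumes r: "r\<^sup>2 + z\<^sup>2 = 1" and s: "s\<^sup>2 + w\<^sup>2 = 1" and sr: "0 \<le> s" "s \<le> r"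
  shows "1 \<le> (z - w)\<^sup>2 + (r - s)\<^sup>2 \<or> (z - w)\<^sup>2 \<le> 2 * r\<^sup>2 * ((z - w)\<^sup>2 + (r - s)\<^sup>2)"
proof (cases "0 \<le> z * w \<or> 1 / 2 \<le> r\<^sup>2")
  case True
  define D where "D = (z - w)\<^sup>2 + (r - s)\<^sup>2"
  have D: "D = 2 * (1 - z * w - r * s)"
    using r s unfolding D_def by algebra
  have D0: "D \<ge> 0" by (simp add: D_def)
  have "1 + r * s - z * w \<le> 4 * r\<^sup>2"
    using True
  proof
    assume zw: "0 \<le> z * w"
    have s2: "s\<^sup>2 \<le> r\<^sup>2" using sr by (simp add: power_mono)
    then have "\<bar>z\<bar> \<le> \<bar>w\<bar>" using r s by (simp add: abs_le_square_iff)
    then have "z\<^sup>2 \<le> z * w"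
      using zw mult_left_mono[of "\<bar>z\<bar>" "\<bar>w\<bar>" "\<bar>z\<bar>"]
      by (simp add: power2_eq_square flip: abs_mult)
    moreover have "r * s \<le> r\<^sup>2" using sr by (simp add: power2_eq_square mult_left_mono)
    ultimately show ?thesis using r by (smt (verit) zero_le_power2)
  next
    assume "1 / 2 \<le> r\<^sup>2"
    moreover have "r * s - z * w \<le> 1"
      using r s zero_le_power2[of "r - s"] zero_le_power2[of "z + w"]
      by (simp add: power2_sum power2_diff)
    ultimately show ?thesis by simp
  qed
  then have "D / 2 * (1 + r * s - z * w) \<le> D / 2 * (4 * r\<^sup>2)"
    using D0 by (intro mult_left_mono) auto
  moreover have "D / 2 * (1 + r * s - z * w) = (z - w)\<^sup>2"
    using r s unfolding D by algebra
  ultimately show ?thesis by (simp add: D_def mult.commute mult.left_commute)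
next
  case False
  have "s\<^sup>2 \<le> r\<^sup>2" using sr by (simp add: power_mono)
  then have "1 \<le> z\<^sup>2 + w\<^sup>2" using False r s by linarith
  also have "\<dots> \<le> (z - w)\<^sup>2" using False by (simp add: power2_diff mult.commute)
  finally show ?thesis by (smt (verit) zero_le_power2)
qed

section \<open>The Fibonacci configurations\<close>

lemma sin_fib_latitude:
  "\<bar>i\<bar> \<le> int N \<Longrightarrow> sin (fib_latitude N i) = 2 * of_int i / (2 * real N + 1)"
  using fib_latitude_unique[of N i "fib_latitude N i"] by (auto simp: abs_le_iff)

lemma cos_fib_latitude_nonneg: "\<bar>i\<bar> \<le> int N \<Longrightarrow> 0 \<le> cos (fib_latitude N i)"
  using fib_latitude_unique[of N i "fib_latitude N i"]
  by (intro cos_ge_zero) (auto simp: abs_le_iff)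

section \<open>Lower bound for the separation\<close>

text \<open>With \<open>M = 2 * N + 1\<close> the extreme heights are
  \<open>\<plusminus>(M - 1) / M\<close>, not \<open>\<plusminus>1\<close>, so every point keeps a
  distance of order at least \<open>1 / sqrt M\<close> from the axis.\<close>

lemma cos_fib_latitude_ge:
  assumes "\<bar>i\<bar> \<le> int N"
  shows "1 / (2 * real N + 1) \<le> (cos (fib_latitude N i))\<^sup>2"
proof -
  have "(of_int i)\<^sup>2 \<le> (real N)\<^sup>2"
    using assms by (intro abs_le_square_iff[THEN iffD1]) linarith
  then have "2 * real N + 1 \<le> (2 * real N + 1)\<^sup>2 - (2 * of_int i)\<^sup>2"
    by (simp add: power2_eq_square algebra_simps)
  then have "(2 * real N + 1) / (2 * real N + 1)\<^sup>2
      \<le> ((2 * real N + 1)\<^sup>2 - (2 * of_int i)\<^sup>2) / (2 * real N + 1)\<^sup>2"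
    by (rule divide_right_mono) simp
  also have "\<dots> = 1 - (2 * of_int i / (2 * real N + 1))\<^sup>2"
    unfolding power_divide diff_divide_distrib by simp
  finally have "(2 * real N + 1) / (2 * real N + 1)\<^sup>2 \<le> 1 - (2 * of_int i / (2 * real N + 1))\<^sup>2" .
  then show ?thesis
    unfolding cos_squared_eq sin_fib_latitude[OF assms] by (simp add: power2_eq_square)
qed

lemma fib_dist_ge_aux:
  assumes i: "\<bar>i\<bar> \<le> int N" and j: "\<bar>j\<bar> \<le> int N" and ij: "i \<noteq> j"
    and le: "cos (fib_latitude N j) \<le> cos (fib_latitude N i)"
  shows "1 / (4 * (2 * real N + 1)) \<le>
    (dist (geo_point (fib_latitude N i) (fib_longitude i)) (geo_point (fib_latitude N j) (fib_longitude j)))\<^sup>2"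
    (is "_ \<le> ?d\<^sup>2")
proof -
  define M where "M = 2 * real N + 1"
  define r s z w where "r = cos (fib_latitude N i)" and "s = cos (fib_latitude N j)"
    and "z = sin (fib_latitude N i)" and "w = sin (fib_latitude N j)"
  define k where "k = real_of_int (i - j)"
  define S where "S = sin (pi * (k * inverse golden_ratio))"
  have M: "M \<ge> 1" by (simp add: M_def)
  have k: "\<bar>k\<bar> \<ge> 1" using ij unfolding k_def by linarith
  have k2: "k\<^sup>2 \<noteq> 0" using k by auto
  have zw: "z - w = 2 * k / M"
    using i j by (simp add: z_def w_def M_def k_def sin_fib_latitude diff_divide_distrib)
  have r2: "1 / M \<le> r\<^sup>2" using cos_fib_latitude_ge[OF i] by (simp add: M_def r_def)
  have r2pos: "r\<^sup>2 > 0" using r2 M by (smt (verit) divide_pos_pos)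
  have sr: "0 \<le> s" "s \<le> r" using le cos_fib_latitude_nonneg[OF j] by (auto simp: r_def s_def)
  have d: "?d\<^sup>2 = (z - w)\<^sup>2 + (r - s)\<^sup>2 + 4 * (r * s) * S\<^sup>2"
  proof -
    have "(fib_longitude i - fib_longitude j) / 2 = pi * (k * inverse golden_ratio)"
      by (simp add: fib_longitude_def k_def left_diff_distrib right_diff_distrib)
    then show ?thesis by (simp add: dist_geo_point r_def s_def z_def w_def S_def)
  qed
  have rsS: "0 \<le> 4 * (r * s) * S\<^sup>2" using sr by simp
  have M4: "1 / (4 * M) \<le> 1" using M by (simp add: field_simps)
  have "(2 / (3 * k))\<^sup>2 \<le> S\<^sup>2"
  proof (rule abs_le_square_iff[THEN iffD1])
    have "2 * (1 / (3 * \<bar>k\<bar>)) \<le> 2 * \<bar>k * inverse golden_ratio - of_int (round (k * inverse golden_ratio))\<bar>"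
      unfolding k_def using ij by (intro mult_left_mono golden_ratio_badly_approximable) auto
    also have "\<dots> \<le> \<bar>S\<bar>" unfolding S_def by (rule abs_sin_pi_ge)
    finally show "\<bar>2 / (3 * k)\<bar> \<le> \<bar>S\<bar>" by (simp add: abs_mult)
  qed
  then have S2: "4 / (9 * k\<^sup>2) \<le> S\<^sup>2" by (simp add: power_divide power_mult_distrib)
  \<comment> \<open>Either the radii differ by more than \<open>r / 2\<close>, which is already of
    order \<open>1 / sqrt M\<close>, or the points are far apart, or the radii are comparable and
    the two parts of the distance must be balanced.\<close>
  consider "2 * s < r" | "1 \<le> (z - w)\<^sup>2 + (r - s)\<^sup>2"
    | "r \<le> 2 * s" "(z - w)\<^sup>2 \<le> 2 * r\<^sup>2 * ((z - w)\<^sup>2 + (r - s)\<^sup>2)"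
    using chord_ge[of r z s w] sr by (force simp: r_def s_def z_def w_def)
  then have "1 / (4 * M) \<le> (z - w)\<^sup>2 + (r - s)\<^sup>2 + 4 * (r * s) * S\<^sup>2"
  proof cases
    case 1
    have "(r / 2)\<^sup>2 \<le> (r - s)\<^sup>2" using 1 sr by (intro power_mono) auto
    then have "r\<^sup>2 / 4 \<le> (r - s)\<^sup>2" by (simp add: power_divide)
    moreover have "1 / (4 * M) = (1 / M) / 4" by simp
    ultimately show ?thesis using r2 rsS zero_le_power2[of "z - w"] by linarith
  next
    case 2
    then show ?thesis using M4 rsS by linarith
  next
    case 3
    text \<open>The latitudinal and the longitudinal part are \<open>2 * X / M\<close> and \<open>8 / (9 * X * M)\<close>, so they
      cannot both be small.\<close>
    define X where "X = k\<^sup>2 / (M * r\<^sup>2)"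
    have X: "X > 0" using k2 M r2pos by (simp add: X_def)
    have A: "2 * X / M \<le> (z - w)\<^sup>2 + (r - s)\<^sup>2"
    proof -
      have "(z - w)\<^sup>2 / (2 * r\<^sup>2) \<le> (z - w)\<^sup>2 + (r - s)\<^sup>2"
        using 3 r2pos by (simp add: divide_le_eq mult.commute)
      moreover have "(z - w)\<^sup>2 / (2 * r\<^sup>2) = 2 * X / M"
        unfolding zw X_def by (simp add: power_divide power_mult_distrib power2_eq_square)
      ultimately show ?thesis by simp
    qed
    have B: "8 / (9 * X * M) \<le> 4 * (r * s) * S\<^sup>2"
    proof -
      have "8 / (9 * X * M) = 2 * r\<^sup>2 * (4 / (9 * k\<^sup>2))"
        using M by (simp add: X_def)
      also have "\<dots> \<le> 4 * (r * s) * S\<^sup>2"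
      proof (rule mult_mono[OF _ S2])
        show "2 * r\<^sup>2 \<le> 4 * (r * s)"
          using mult_left_mono[OF 3(1), of r] sr by (simp add: power2_eq_square)
      qed (use sr in auto)
      finally show ?thesis .
    qed
    show ?thesis
    \<comment> \<open>At \<open>X = 1 / 8\<close> the latitudinal part \<open>2 * X / M\<close>
      equals the target \<open>1 / (4 * M)\<close>; below that value the longitudinal part exceeds
      \<open>64 / (9 * M)\<close>.\<close>
    proof (cases "X \<ge> 1 / 8")
      case True
      then have "1 / (4 * M) \<le> 2 * X / M" using M by (simp add: field_simps)
      then show ?thesis using A rsS by linarith
    next
      case False
      then have "1 / (4 * M) \<le> 8 / (9 * X * M)" using M X by (simp add: field_simps)
      moreover have "0 \<le> (z - w)\<^sup>2 + (r - s)\<^sup>2" by simp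
      ultimately show ?thesis using B by linarith
    qed
  qed
  then show ?thesis using d by (simp add: M_def)
qed

lemma separation_fibonacci_config_ge:
  assumes "N \<ge> 1"
  shows "1 / (2 * sqrt (2 * real N + 1)) \<le> separation (fibonacci_config N)"
proof -
  let ?w = "fibonacci_config N"
  let ?D = "{dist x y | x y. x \<in> ?w \<and> y \<in> ?w \<and> x \<noteq> y}"
  have fin: "finite ?w" by (simp add: fibonacci_config_def)
  have "?D \<subseteq> (\<lambda>(x, y). dist x y) ` (?w \<times> ?w)" by auto
  then have finD: "finite ?D" using fin finite_subset by blast
  have "\<not> card ?w \<le> Suc 0" using assms by (simp add: card_fibonacci_config)
  then have "?D \<noteq> {}" using fin by (auto simp: card_le_Suc0_iff_eq)
  moreover have "1 / (2 * sqrt (2 * real N + 1)) \<le> dist x y"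
    if xy: "x \<in> ?w" "y \<in> ?w" "x \<noteq> y" for x y
  proof (rule power2_le_imp_le)
    obtain i j where ij: "\<bar>i\<bar> \<le> int N" "\<bar>j\<bar> \<le> int N"
      and x: "x = geo_point (fib_latitude N i) (fib_longitude i)"
      and y: "y = geo_point (fib_latitude N j) (fib_longitude j)"
      using xy unfolding fibonacci_config_def by force
    then have "i \<noteq> j" using xy by auto
    then have "1 / (4 * (2 * real N + 1)) \<le> (dist x y)\<^sup>2"
      using fib_dist_ge_aux[of i N j] fib_dist_ge_aux[of j N i] ij unfolding x y
      by (cases "cos (fib_latitude N j) \<le> cos (fib_latitude N i)") (auto simp: dist_commute)
    then show "(1 / (2 * sqrt (2 * real N + 1)))\<^sup>2 \<le> (dist x y)\<^sup>2"
      by (simp add: power_divide power_mult_distrib)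
  qed simp
  ultimately show ?thesis
    unfolding separation_def using finD by (subst Min_ge_iff) auto
qed

section \<open>Upper bound for the covering radius\<close>

text \<open>Closeness in height passes to closeness in distance from the axis because
  \<open>r\<^sup>2 - R\<^sup>2 = - ((z + Z) * (z - Z))\<close> and
  \<open>\<bar>z + Z\<bar> \<le> 2\<close>. The tolerance on the height shrinks with
  \<open>R\<close>, since heights vary slowly near the poles.\<close>

lemma abs_cos_diff_le:
  fixes r R z Z \<rho> :: real
  assumes rR: "0 \<le> r" "0 \<le> R" and \<rho>: "0 < \<rho>"
    and r: "r\<^sup>2 + z\<^sup>2 = 1" and R: "R\<^sup>2 + Z\<^sup>2 = 1"
    and zZ: "\<bar>z - Z\<bar> \<le> 2 * \<rho> * (R + \<rho>)"
  shows "\<bar>r - R\<bar> \<le> 8 * \<rho>" "r \<le> R + 2 * \<rho>"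
proof -
  have z1: "\<bar>z\<bar> \<le> 1" "\<bar>Z\<bar> \<le> 1"
    using r R zero_le_power2[of r] zero_le_power2[of R]
    by (simp_all only: abs_square_le_1[symmetric])
  have "\<bar>r\<^sup>2 - R\<^sup>2\<bar> = \<bar>z + Z\<bar> * \<bar>z - Z\<bar>"
  proof -
    have "r\<^sup>2 - R\<^sup>2 = - ((z + Z) * (z - Z))" using r R by algebra
    then show ?thesis by (simp only: abs_minus_cancel abs_mult)
  qed
  also have "\<dots> \<le> 2 * (2 * \<rho> * (R + \<rho>))"
    using zZ z1 by (intro mult_mono) auto
  finally have sq: "\<bar>r\<^sup>2 - R\<^sup>2\<bar> \<le> 4 * \<rho> * (R + \<rho>)" by simp
  show up: "r \<le> R + 2 * \<rho>"
  proof (rule power2_le_imp_le)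
    show "r\<^sup>2 \<le> (R + 2 * \<rho>)\<^sup>2"
      using sq by (simp add: power2_eq_square algebra_simps)
  qed (use rR \<rho> in auto)
  have "R - 8 * \<rho> \<le> r"
  proof (rule ccontr)
    assume c: "\<not> R - 8 * \<rho> \<le> r"
    then have "R\<^sup>2 - r\<^sup>2 \<ge> 8 * \<rho> * R"
    proof -
      have "R\<^sup>2 - r\<^sup>2 = (R - r) * (R + r)" by (simp add: power2_eq_square algebra_simps)
      also have "\<dots> \<ge> 8 * \<rho> * R" using c rR \<rho> by (intro mult_mono) auto
      finally show ?thesis .
    qed
    moreover have "4 * \<rho> * (R + \<rho>) < 8 * \<rho> * R" using c rR \<rho> by simp
    ultimately show False using sq by linarith
  qed
  then show "\<bar>r - R\<bar> \<le> 8 * \<rho>" using up \<rho> by linarith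
qed

text \<open>The real number \<open>Z * (N + 1 / 2)\<close> is the index at which the height would be
  \<open>Z\<close>. The window extends from it towards the equator, so that it stays inside the
  index range even when \<open>Z\<close> is near a pole.\<close>

lemma index_window:
  assumes Z: "\<bar>Z\<bar> \<le> 1" and K: "1 \<le> K" "K \<le> int N + 1"
  shows "\<exists>n. \<forall>i. n \<le> i \<and> i < n + K \<longrightarrow>
    \<bar>i\<bar> \<le> int N \<and> \<bar>of_int i - Z * (real N + 1 / 2)\<bar> \<le> of_int K"
proof (cases "Z \<ge> 0")
  case True
  define m where "m = \<lfloor>Z * (real N + 1 / 2)\<rfloor>"
  have le: "Z * (real N + 1 / 2) \<le> real N + 1 / 2"
    using Z mult_right_mono[of Z 1 "real N + 1 / 2"] by simp
  have m: "of_int m \<le> Z * (real N + 1 / 2)" "Z * (real N + 1 / 2) < of_int m + 1"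
    by (auto simp: m_def)
  have "0 \<le> m" using True by (simp add: m_def)
  moreover have "m < int N + 1"
    proof -
    have "real_of_int m < real N + 1" using m(1) le by linarith
    then show ?thesis by linarith
  qed
  ultimately show ?thesis
    \<comment> \<open>The window ends at \<open>m\<close>; its lowest index is at least
      \<open>- N\<close> since \<open>0 \<le> m\<close> and \<open>K \<le> N + 1\<close>.\<close>
    using m K by (intro exI[of _ "m - K + 1"]) auto
next
  case False
  define m where "m = \<lceil>Z * (real N + 1 / 2)\<rceil>"
  have le: "(- 1) * (real N + 1 / 2) \<le> Z * (real N + 1 / 2)"
    using Z by (intro mult_right_mono) auto
  have m: "Z * (real N + 1 / 2) \<le> of_int m" "of_int m - 1 < Z * (real N + 1 / 2)"
    unfolding m_def by linarith+
  have "Z * (real N + 1 / 2) \<le> 0" using False by (simp add: mult_nonpos_nonneg)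
  then have "m \<le> 0" by (simp add: m_def)
  moreover have "- int N - 1 < m"
    using m le by (simp only: of_int_less_iff[where 'a = real, symmetric]) simp
  ultimately show ?thesis
    using m K by (intro exI[of _ m]) auto
qed

text \<open>\<open>K\<close> indices around the height of \<open>y\<close> keep the latitudinal
  error of order \<open>\<rho>\<close>, while their longitudes come within order
  \<open>1 / K\<close> of that of \<open>y\<close>. The circle has radius at most
  \<open>\<rho> * K\<close>, so the longitudinal error is of order \<open>\<rho>\<close> too. The
  bound \<open>K \<ge> 1\<close> covers the poles, where \<open>R * sqrt M\<close> vanishes.\<close>

lemma fib_point_near:
  assumes "y \<in> sphere 0 1"
  shows "\<exists>x\<in>fibonacci_config N. dist x y \<le> 50 / sqrt (2 * real N + 1)"
proof -
  obtain a t where y: "y = geo_point a t" and a: "- (pi / 2) \<le> a" "a \<le> pi / 2"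
    using sphere_eq_geo_point[OF assms] .
  define M where "M = 2 * real N + 1"
  define \<rho> where "\<rho> = 1 / sqrt M"
  define R Z where "R = cos a" and "Z = sin a"
  have M: "M \<ge> 1" by (simp add: M_def)
  have \<rho>: "0 < \<rho>" "\<rho> \<le> 1" "\<rho>\<^sup>2 = 1 / M" "\<rho> * sqrt M = 1"
    using M by (auto simp: \<rho>_def power_divide)
  have R: "0 \<le> R" "R \<le> 1" using a by (auto simp: R_def cos_ge_zero)
  text \<open>The circle of latitude through \<open>y\<close> has radius \<open>R\<close>, and \<open>K\<close> is the number of points that
    lie in a band of width comparable to \<open>\<rho>\<close> around it.\<close>
  define K where "K = max 1 \<lceil>R * sqrt M\<rceil>"
  have K1: "1 \<le> K" by (simp add: K_def)
  have KR: "R * sqrt M \<le> of_int K" "of_int K \<le> R * sqrt M + 1"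
    using R M unfolding K_def by (auto simp: max_def)
  have KN: "K \<le> int N + 1"
  proof -
    have "R * sqrt M \<le> 1 * sqrt M" using R M by (intro mult_right_mono) auto
    also have "sqrt M \<le> real N + 1"
      by (rule real_le_lsqrt) (auto simp: M_def power2_eq_square algebra_simps)
    finally have "\<lceil>R * sqrt M\<rceil> \<le> int N + 1" by (simp add: ceiling_le_iff)
    then show ?thesis by (simp add: K_def)
  qed
  have \<rho>K: "R \<le> \<rho> * of_int K" "\<rho> * of_int K \<le> R + \<rho>"
  proof -
    have e: "\<rho> * (R * sqrt M) = R" using \<rho>(4) by (metis mult.left_commute mult.right_neutral)
    show "R \<le> \<rho> * of_int K" using mult_left_mono[OF KR(1), of \<rho>] \<rho> e by simp
    show "\<rho> * of_int K \<le> R + \<rho>" using mult_left_mono[OF KR(2), of \<rho>] \<rho> e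
      by (simp add: distrib_left)
  qed
  obtain n where n: "\<And>i. n \<le> i \<Longrightarrow> i < n + K \<Longrightarrow>
      \<bar>i\<bar> \<le> int N \<and> \<bar>of_int i - Z * (real N + 1 / 2)\<bar> \<le> of_int K"
    using index_window[of Z K N] K1 KN by (auto simp: Z_def)
  obtain i p where ip: "n \<le> i" "i < n + K"
    and app: "\<bar>of_int i * inverse golden_ratio - t / (2 * pi) - of_int p\<bar> \<le> 3 / of_int K"
    using golden_ratio_multiples_dense[OF K1, of n "t / (2 * pi)"] by blast
  have i: "\<bar>i\<bar> \<le> int N" and iZ: "\<bar>of_int i - Z * (real N + 1 / 2)\<bar> \<le> of_int K"
    using n[OF ip] by auto
  define r z where "r = cos (fib_latitude N i)" and "z = sin (fib_latitude N i)"
  define x where "x = geo_point (fib_latitude N i) (fib_longitude i)"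
  define S where "S = sin ((fib_longitude i - t) / 2)"
  have d: "(dist x y)\<^sup>2 = (z - Z)\<^sup>2 + (r - R)\<^sup>2 + 4 * (r * R) * S\<^sup>2"
    by (simp add: x_def y dist_geo_point r_def z_def R_def Z_def S_def)
  have "z - Z = (of_int i - Z * (real N + 1 / 2)) * (2 / M)"
    using i M by (simp add: z_def sin_fib_latitude M_def field_simps)
  then have "\<bar>z - Z\<bar> = \<bar>of_int i - Z * (real N + 1 / 2)\<bar> * (2 / M)"
    using M by (simp only: abs_mult) simp
  also have "\<dots> \<le> of_int K * (2 / M)"
    using iZ M by (intro mult_right_mono) auto
  also have "\<dots> = of_int K * (2 * \<rho>\<^sup>2)" using \<rho>(3) by simp
  also have "\<dots> = 2 * \<rho> * (\<rho> * of_int K)" by (simp add: power2_eq_square)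
  also have "\<dots> \<le> 2 * \<rho> * (R + \<rho>)"
    using \<rho>K \<rho> by (intro mult_left_mono) auto
  finally have zZ: "\<bar>z - Z\<bar> \<le> 2 * \<rho> * (R + \<rho>)" .
  have r0: "0 \<le> r" using cos_fib_latitude_nonneg[OF i] by (simp add: r_def)
  have rR: "\<bar>r - R\<bar> \<le> 8 * \<rho>" "r \<le> R + 2 * \<rho>"
    using abs_cos_diff_le[OF r0 R(1) \<rho>(1) _ _ zZ] by (auto simp: r_def z_def R_def Z_def)
  have "2 * \<rho> * (R + \<rho>) \<le> 2 * \<rho> * 2" using R \<rho> by (intro mult_left_mono) auto
  then have "\<bar>z - Z\<bar> \<le> 4 * \<rho>" using zZ by linarith
  then have "(z - Z)\<^sup>2 \<le> (4 * \<rho>)\<^sup>2"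
    using \<rho> by (intro abs_le_square_iff[THEN iffD1]) auto
  moreover have "(r - R)\<^sup>2 \<le> (8 * \<rho>)\<^sup>2"
    using rR \<rho> by (intro abs_le_square_iff[THEN iffD1]) auto
  \<comment> \<open>The constant is 4 * 3 * 12 * 12, where 12 comes from \<open>pi < 4\<close> and
    the density bound \<open>3 / K\<close>; the powers of \<open>K\<close> cancel.\<close>
  moreover have "4 * (r * R) * S\<^sup>2 \<le> 1728 * \<rho>\<^sup>2"
  proof -
    define k where "k = real_of_int K"
    have k: "k \<ge> 1" using K1 unfolding k_def by linarith
    have "\<bar>S\<bar> = \<bar>sin (pi * (of_int i * inverse golden_ratio - t / (2 * pi) - of_int p))\<bar>"
      by (simp add: abs_sin_pi_diff_int)
        (simp add: S_def fib_longitude_def right_diff_distrib diff_divide_distrib mult.assoc)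
    also have "\<dots> \<le> pi * \<bar>of_int i * inverse golden_ratio - t / (2 * pi) - of_int p\<bar>"
      by (rule order.trans[OF abs_sin_x_le_abs_x]) (simp add: abs_mult)
    also have "\<dots> \<le> 4 * (3 / k)"
      using app pi_less_4 by (intro mult_mono) (auto simp: k_def)
    finally have "\<bar>S\<bar> \<le> \<bar>12 / k\<bar>" using k by simp
    then have S2: "S\<^sup>2 \<le> (12 / k)\<^sup>2" by (rule abs_le_square_iff[THEN iffD1])
    have "r * R \<le> (R + 2 * \<rho>) * R" using rR R by (intro mult_right_mono) auto
    also have "\<dots> \<le> (3 * (\<rho> * k)) * (\<rho> * k)"
    proof (rule mult_mono)
      have "\<rho> * 1 \<le> \<rho> * k" using k \<rho> by (intro mult_left_mono) auto
      then show "R + 2 * \<rho> \<le> 3 * (\<rho> * k)" using \<rho>K(1) by (simp add: k_def)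
    qed (use \<rho>K R \<rho> k in \<open>auto simp: k_def\<close>)
    also have "\<dots> = 3 * \<rho>\<^sup>2 * k\<^sup>2" by (simp add: power2_eq_square)
    finally have "4 * (r * R) \<le> 4 * (3 * \<rho>\<^sup>2 * k\<^sup>2)" by linarith
    then have "4 * (r * R) * S\<^sup>2 \<le> 4 * (3 * \<rho>\<^sup>2 * k\<^sup>2) * (12 / k)\<^sup>2"
      using S2 by (rule mult_mono) auto
    also have "\<dots> = 1728 * \<rho>\<^sup>2" using k by (simp add: power_divide)
    finally show ?thesis .
  qed
  ultimately have "(dist x y)\<^sup>2 \<le> (4 * \<rho>)\<^sup>2 + (8 * \<rho>)\<^sup>2 + 1728 * \<rho>\<^sup>2"
    unfolding d by linarith
  \<comment> \<open>The coefficients add up to 16 + 64 + 1728 = 1808, below 2500.\<close>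
  also have "\<dots> \<le> (50 * \<rho>)\<^sup>2" by (simp add: power_mult_distrib)
  finally have "(dist x y)\<^sup>2 \<le> (50 * \<rho>)\<^sup>2" .
  then have "dist x y \<le> 50 * \<rho>" by (rule power2_le_imp_le) (use \<rho> in simp)
  moreover have "x \<in> fibonacci_config N"
    using i unfolding x_def fibonacci_config_def by (intro imageI) auto
  ultimately show ?thesis by (auto simp: \<rho>_def M_def)
qed

lemma covering_radius_fibonacci_config:
  "0 \<le> covering_radius (fibonacci_config N)"
  "covering_radius (fibonacci_config N) \<le> 50 / sqrt (2 * real N + 1)"
proof -
  let ?w = "fibonacci_config N"
  have w: "finite ?w" "?w \<noteq> {}" by (auto simp: fibonacci_config_def)
  then obtain y where y: "y \<in> sphere 0 1" "covering_radius ?w = Min ((\<lambda>x. dist x y) ` ?w)"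
    using covering_radius_attained by blast
  show "0 \<le> covering_radius ?w" unfolding y(2) using w by (subst Min_ge_iff) auto
  show "covering_radius ?w \<le> 50 / sqrt (2 * real N + 1)"
    unfolding y(2) using w fib_point_near[OF y(1), of N] by (subst Min_le_iff) auto
qed

theorem proposition2:
  shows "quasi_uniform_on {1..} fibonacci_config"
  unfolding quasi_uniform_on_def
proof (intro conjI ballI)
  fix N :: nat
  assume "N \<in> {1..}"
  then show "spherical_config (fibonacci_config N)"
    using geo_point_in_sphere card_fibonacci_config[of N]
    unfolding spherical_config_def by (auto simp: fibonacci_config_def)
next
  show "bounded ((\<lambda>N. mesh_ratio (fibonacci_config N)) ` {1..})"
    unfolding bounded_iff
  \<comment> \<open>The value 100 is the covering bound \<open>50 / c\<close> divided by the
    separation bound \<open>1 / (2 * c)\<close>.\<close>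
  proof (intro exI[of _ 100] ballI, elim imageE)
    fix x and N :: nat
    assume x: "x = mesh_ratio (fibonacci_config N)" and "N \<in> {1..}"
    define c where "c = sqrt (2 * real N + 1)"
    have c: "c > 0" by (simp add: c_def)
    have sep: "1 / (2 * c) \<le> separation (fibonacci_config N)"
      using separation_fibonacci_config_ge \<open>N \<in> {1..}\<close> by (simp add: c_def)
    have "0 < 1 / (2 * c)" using c by simp
    then have "0 < separation (fibonacci_config N)" using sep by linarith
    then have "norm x = mesh_ratio (fibonacci_config N)"
      unfolding x mesh_ratio_def using covering_radius_fibonacci_config(1)[of N] by simp
    also have "\<dots> \<le> (50 / c) / (1 / (2 * c))"
      unfolding mesh_ratio_def
      using sep covering_radius_fibonacci_config[of N] \<open>0 < 1 / (2 * c)\<close> c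
      by (intro frac_le) (auto simp: c_def)
    also have "\<dots> = 100" using c by simp
    finally show "norm x \<le> 100" .
  qed
qed

end
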